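(* Let $L$ be a Lie superalgebra over a field of characteristic zero, and let $P\colon L\to L$ be an even (parity-preserving) linear map with $P^2=P$ such that for all $a,b\in L$ $$[Pa,Pb]=0\qquad\text{and}\qquad P[a,b]=P[Pa,b]+P[a,Pb].$$ Let $V=P(L)$, let $\Delta\in L$ be an arbitrary odd element, and let $\Delta^2:=\tfrac12[\Delta,\Delta]\in L$. Then for every $n\geq 0$ the $n$-th Jacobiator $J^n_\Delta$ of the derived brackets of $\Delta$ equals the $n$-th derived bracket of $\Delta^2$: $$J^n_{\Delta}(a_1,\ldots,a_n)=\{a_1,\ldots,a_n\}_{\Delta^2}\qquad\text{for all } a_1,\ldots,a_n\in V.$$
   Context: All vector spaces are $\mathbb{Z}_2$-graded; $\tilde a\in\mathbb Z_2$ denotes the parity of a homogeneous element $a$. Formulas with signs are stated for homogeneous elements and extended by multilinearity. Derived brackets: for any homogeneous element $E\in L$ (even or odd) and $n\geq 0$, the $n$-th derived bracket of $E$ is the $n$-linear operation on $V=P(L)$ $$\{a_1,\ldots,a_n\}_E:=P[\ldots[[E,a_1],a_2],\ldots,a_n],\qquad a_i\in V,$$ where for $n=0$ this is the element $\{\varnothing\}_E:=P(E)\in V$. These operations have the same parity as $E$ and are symmetric in the $\mathbb Z_2$-graded sense (interchanging adjacent arguments $a_i,a_{i+1}$ produces the sign $(-1)^{\tilde a_i\tilde a_{i+1}}$). Jacobiators: for a sequence of odd symmetric $n$-linear operations $\{\cdot,\ldots,\cdot\}$, $n=0,1,2,\ldots$, on $V$, the $n$-th Jacobiator is $$J^n(a_1,\ldots,a_n):=\sum_{k+l=n}\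 \sum_{(k,l)\text{-shuffles }\sigma}(-1)^{\alpha}\,\{\{a_{\sigma(1)},\ldots,a_{\sigma(k)}\},a_{\sigma(k+1)},\ldots,a_{\sigma(k+l)}\},$$ with $k,l\ge 0$. A $(k,l)$-shuffle is a permutation $\sigma$ of $1,\ldots,k+l$ with $\sigma(1)<\dots<\sigma(k)$ and $\sigma(k+1)<\dots<\sigma(k+l)$. The sign $(-1)^\alpha$ is the Koszul sign of the permutation $(a_1,\ldots,a_n)\mapsto(a_{\sigma(1)},\ldots,a_{\sigma(n)})$ of homogeneous elements: a factor $(-1)^{\tilde a\tilde b}$ for every transposition of adjacent elements $a,b$, and no other signs. For $k=0$ the inner bracket is the $0$-ary bracket $\{\varnothing\}$. $J^n_\Delta$ denotes the $n$-th Jacobiator of the derived brackets $\{\cdot,\ldots,\cdot\}_\Delta$ of the odd element $\Delta$. *)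

theory Defs
  imports Complex_Main "HOL-Library.Z2" "HOL-Combinatorics.Permutations"
begin

section \<open>Signs and shuffles\<close>

text \<open>Parities are elements of \<^typ>\<open>bit\<close>, the field with two elements.\<close>

definition parity_sign :: "bit \<Rightarrow> bit \<Rightarrow> 'k::comm_ring_1"
  where "parity_sign p q = (- 1) ^ of_bit (p * q)"

text \<open>
  For a list \<open>ps\<close> of parities, \<open>koszul_sign ps \<sigma>\<close> is the sign of the rearrangement of
  \<open>a\<^sub>0, \<dots>, a\<^sub>n\<^sub>-\<^sub>1\<close> into \<open>a\<^bsub>\<sigma> 0\<^esub>, \<dots>, a\<^bsub>\<sigma> (n-1)\<^esub>\<close>. Each pair whose order is reversed
  contributes one factor. The lemmas \<open>koszul_sign_id\<close> and \<open>koszul_sign_transpose\<close> show that this is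
  the sign obtained by composing transpositions of adjacent elements.
\<close>

definition koszul_sign :: "bit list \<Rightarrow> (nat \<Rightarrow> nat) \<Rightarrow> 'k::comm_ring_1"
  where "koszul_sign ps \<sigma> =
    (\<Prod>(i, j) \<in> {(i, j). i < j \<and> j < length ps \<and> \<sigma> j < \<sigma> i}. parity_sign (ps ! \<sigma> i) (ps ! \<sigma> j))"

text \<open>Indices start at \<open>0\<close>, so permutations act on \<open>{..<k + l}\<close>.\<close>

definition shuffle_perms :: "nat \<Rightarrow> nat \<Rightarrow> (nat \<Rightarrow> nat) set"
  where "shuffle_perms k l =
    {\<sigma>. \<sigma> permutes {..<k + l} \<and> strict_mono_on {..<k} \<sigma> \<and> strict_mono_on {k..<k + l} \<sigma>}"

lemma parity_sign_commute: "parity_sign p q = parity_sign q p"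
  by (simp add: parity_sign_def mult.commute)

lemma parity_sign_square: "parity_sign p q * parity_sign p q = (1 :: 'k::comm_ring_1)"
  by (simp add: parity_sign_def flip: power_add)

lemma koszul_sign_id: "koszul_sign ps id = (1 :: 'k::comm_ring_1)"
proof -
  have "{(i, j). i < j \<and> j < length ps \<and> id j < id i} = {}" by auto
  then show ?thesis by (simp only: koszul_sign_def prod.empty)
qed

lemma koszul_sign_alt:
  "(koszul_sign ps \<sigma> :: 'k::comm_ring_1) =
    (\<Prod>x \<in> {(i, j). i < j \<and> j < length ps}.
      if \<sigma> (snd x) < \<sigma> (fst x) then parity_sign (ps ! \<sigma> (fst x)) (ps ! \<sigma> (snd x)) else 1)"
proof -
  let ?S = "{(i, j). i < j \<and> j < length ps}"
  have fin: "finite ?S"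
    by (rule finite_subset [of _ "{..<length ps} \<times> {..<length ps}"]) auto
  have "{(i, j). i < j \<and> j < length ps \<and> \<sigma> j < \<sigma> i} = {x \<in> ?S. \<sigma> (snd x) < \<sigma> (fst x)}"
    by auto
  then have "(koszul_sign ps \<sigma> :: 'k) = (\<Prod>x \<in> {x \<in> ?S. \<sigma> (snd x) < \<sigma> (fst x)}.
      parity_sign (ps ! \<sigma> (fst x)) (ps ! \<sigma> (snd x)))"
    unfolding koszul_sign_def by (rule prod.cong) auto
  then show ?thesis by (simp only: prod.inter_filter [OF fin])
qed

lemma koszul_sign_transpose:
  assumes \<sigma>: "\<sigma> permutes {..<length ps}" and i: "Suc i < length ps"
  shows "koszul_sign ps (\<sigma> \<circ> transpose i (Suc i)) =
    parity_sign (ps ! \<sigma> i) (ps ! \<sigma> (Suc i)) * (koszul_sign ps \<sigma> :: 'k::comm_ring_1)"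
proof -
  define S where "S = {(i, j). i < j \<and> j < length ps}"
  define f :: "nat \<times> nat \<Rightarrow> 'k" where "f = (\<lambda>x. if \<sigma> (snd x) < \<sigma> (fst x)
    then parity_sign (ps ! \<sigma> (fst x)) (ps ! \<sigma> (snd x)) else 1)"
  define \<tau> where "\<tau> = transpose i (Suc i)"
  define T where "T = S - {(i, Suc i)}"
  let ?m = "\<lambda>x. (\<tau> (fst x), \<tau> (snd x))"
  have fin: "finite S" unfolding S_def
    by (rule finite_subset [of _ "{..<length ps} \<times> {..<length ps}"]) auto
  have mem: "(i, Suc i) \<in> S" using i by (simp add: S_def)
  have split: "prod g S = g (i, Suc i) * prod g T" for g :: "nat \<times> nat \<Rightarrow> 'k"
    unfolding T_def by (rule prod.remove [OF fin mem])
  have inv: "?m (?m x) = x" for x by (simp add: \<tau>_def)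
  have maps: "?m x \<in> T" if "x \<in> T" for x
    using that i by (auto simp: T_def S_def \<tau>_def transpose_def split: if_splits)
  have reindex: "prod (f \<circ> ?m) T = prod f T"
    by (rule prod.reindex_bij_witness [of _ ?m ?m]) (use inv maps in auto)
  have "koszul_sign ps (\<sigma> \<circ> \<tau>) = prod (f \<circ> ?m) S"
    by (simp only: koszul_sign_alt S_def f_def o_def fst_conv snd_conv)
  also have "\<dots> = f (Suc i, i) * prod f T"
    unfolding split reindex by (simp add: \<tau>_def)
  also have "f (Suc i, i) = parity_sign (ps ! \<sigma> i) (ps ! \<sigma> (Suc i)) * f (i, Suc i)"
  proof -
    have "\<sigma> i \<noteq> \<sigma> (Suc i)"
      using permutes_inj [OF \<sigma>] by (metis injD n_not_Suc_n)
    then show ?thesis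
      by (auto simp: f_def parity_sign_square parity_sign_commute)
  qed
  also have "\<dots> * prod f T = parity_sign (ps ! \<sigma> i) (ps ! \<sigma> (Suc i)) * prod f S"
    by (simp add: split mult.assoc)
  also have "prod f S = koszul_sign ps \<sigma>"
    unfolding koszul_sign_alt S_def f_def by simp
  finally show ?thesis by (simp only: \<tau>_def)
qed


section \<open>Superspaces and Jacobiators\<close>

locale super_space = vector_space scale
  for scale :: "'k::field_char_0 \<Rightarrow> 'a::ab_group_add \<Rightarrow> 'a" +
  fixes grade :: "bit \<Rightarrow> 'a set"
  assumes subspace_grade: "subspace (grade p)"
    and grade_Int: "grade 0 \<inter> grade 1 = {0}"
    and grade_sum: "\<exists>u \<in> grade 0. \<exists>v \<in> grade 1. a = u + v"
begin

definition component :: "bit \<Rightarrow> 'a \<Rightarrow> 'a"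
  where "component p a = (THE u. u \<in> grade p \<and> a - u \<in> grade (p + 1))"

text \<open>
  An operation of arbitrary arity is a function on lists. The first definition is the signed sum
  for homogeneous arguments \<open>as\<close> of parities \<open>ps\<close>; the second extends it by multilinearity to
  arbitrary arguments. See \<open>jacobiator_homogeneous\<close> for their agreement.
\<close>

definition homogeneous_jacobiator :: "('a list \<Rightarrow> 'a) \<Rightarrow> bit list \<Rightarrow> 'a list \<Rightarrow> 'a"
  where "homogeneous_jacobiator B ps as =
    (\<Sum>(k, l) \<in> {(k, l). k + l = length as}. \<Sum>\<sigma> \<in> shuffle_perms k l.
      scale (koszul_sign ps \<sigma>)
        (B (B (map (\<lambda>i. as ! \<sigma> i) [0..<k]) # map (\<lambda>i. as ! \<sigma> i) [k..<k + l])))"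

definition jacobiator :: "('a list \<Rightarrow> 'a) \<Rightarrow> 'a list \<Rightarrow> 'a"
  where "jacobiator B as =
    (\<Sum>ps \<in> {ps. length ps = length as}. homogeneous_jacobiator B ps (map2 component ps as))"

lemma component_unique:
  assumes "u \<in> grade p" "a - u \<in> grade (p + 1)"
  shows "component p a = u"
  unfolding component_def
proof (rule the_equality)
  fix w assume w: "w \<in> grade p \<and> a - w \<in> grade (p + 1)"
  have "w - u \<in> grade p" using w assms subspace_diff [OF subspace_grade] by blast
  moreover have "(a - u) - (a - w) \<in> grade (p + 1)"
    using w assms subspace_diff [OF subspace_grade] by blast
  then have "w - u \<in> grade (p + 1)" by (simp add: algebra_simps)
  ultimately have "w - u \<in> grade 0 \<inter> grade 1" by (cases p) auto
  then show "w = u" using grade_Int by auto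
qed (use assms in simp)

lemma component_same: "a \<in> grade p \<Longrightarrow> component p a = a"
  by (rule component_unique) (auto simp: subspace_0 [OF subspace_grade])

lemma component_other:
  assumes "a \<in> grade q" "p \<noteq> q"
  shows "component p a = 0"
proof -
  have "q = p + 1" using assms(2) by (cases p; cases q) auto
  then show ?thesis using assms(1)
    by (intro component_unique) (auto simp: subspace_0 [OF subspace_grade])
qed

lemma component_in_grade: "component p a \<in> grade p"
  and component_sum: "component 0 a + component 1 a = a"
proof -
  obtain u v where uv: "u \<in> grade 0" "v \<in> grade 1" "a = u + v" using grade_sum by blast
  have "component 0 a = u" by (rule component_unique) (use uv in auto)
  moreover have "component 1 a = v" by (rule component_unique) (use uv in auto)
  ultimately show "component p a \<in> grade p" "component 0 a + component 1 a = a"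
    using uv by (cases p; simp)+
qed

lemma homogeneous_jacobiator_zero:
  assumes B: "\<And>xs. 0 \<in> set xs \<Longrightarrow> B xs = 0" and z: "0 \<in> set as"
  shows "homogeneous_jacobiator B ps as = 0"
  unfolding homogeneous_jacobiator_def
proof (intro sum.neutral ballI, clarify, intro sum.neutral ballI)
  fix k l \<sigma> assume n: "k + l = length as" and "\<sigma> \<in> shuffle_perms k l"
  then have "\<sigma> permutes {..<k + l}" by (simp add: shuffle_perms_def)
  moreover obtain j where "j < k + l" "as ! j = 0" using z n by (auto simp: in_set_conv_nth)
  ultimately obtain i where i: "i < k + l" "as ! \<sigma> i = 0"
    by (metis lessThan_iff permutes_def)
  let ?L = "map (\<lambda>i. as ! \<sigma> i) [0..<k]" and ?R = "map (\<lambda>i. as ! \<sigma> i) [k..<k + l]"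
  have "0 \<in> set ?L \<or> 0 \<in> set ?R"
    using i by (cases "i < k") (force simp: image_iff)+
  then have "0 \<in> set (B ?L # ?R)"
    using B [of ?L] by auto
  then show "scale (koszul_sign ps \<sigma>) (B (B ?L # ?R)) = 0"
    using B by simp
qed

lemma jacobiator_homogeneous:
  assumes B: "\<And>xs. 0 \<in> set xs \<Longrightarrow> B xs = 0"
    and ps: "list_all2 (\<lambda>p a. a \<in> grade p) ps as"
  shows "jacobiator B as = homogeneous_jacobiator B ps as"
proof -
  let ?S = "{qs :: bit list. length qs = length as}"
  have UB: "(UNIV :: bit set) = {0, 1}" using bit_not_zero_iff by blast
  have "finite (UNIV :: bit set)" unfolding UB by simp
  then have fin: "finite ?S"
    using finite_lists_length_eq [of "UNIV :: bit set" "length as"] by simp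
  have len: "length ps = length as" using ps by (rule list_all2_lengthD)
  have zero: "homogeneous_jacobiator B qs (map2 component qs as) = 0" if qs: "qs \<in> ?S - {ps}" for qs
  proof -
    obtain i where i: "i < length as" "qs ! i \<noteq> ps ! i"
      using qs len by (auto simp: list_eq_iff_nth_eq)
    then have "component (qs ! i) (as ! i) = 0"
      using ps len by (intro component_other [of _ "ps ! i"]) (auto simp: list_all2_conv_all_nth)
    then have "map2 component qs as ! i = 0" using i qs by simp
    moreover have "i < length (map2 component qs as)" using i qs by simp
    ultimately have "0 \<in> set (map2 component qs as)" unfolding in_set_conv_nth by blast
    then show ?thesis by (rule homogeneous_jacobiator_zero [rotated]) (rule B)
  qed
  have "map2 component ps as = as"
    using ps by (intro nth_equalityI) (auto simp: list_all2_conv_all_nth component_same)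
  moreover have "jacobiator B as = homogeneous_jacobiator B ps (map2 component ps as)"
  proof -
    have "jacobiator B as = homogeneous_jacobiator B ps (map2 component ps as) +
        (\<Sum>qs \<in> ?S - {ps}. homogeneous_jacobiator B qs (map2 component qs as))"
      unfolding jacobiator_def by (rule sum.remove [OF fin]) (simp add: len)
    also have "(\<Sum>qs \<in> ?S - {ps}. homogeneous_jacobiator B qs (map2 component qs as)) = 0"
      using zero by (intro sum.neutral ballI)
    finally show ?thesis by simp
  qed
  ultimately show ?thesis by simp
qed

end


section \<open>Lie superalgebras and derived brackets\<close>

locale lie_superalgebra = super_space scale grade
  for scale :: "'k::field_char_0 \<Rightarrow> 'a::ab_group_add \<Rightarrow> 'a"
    and grade :: "bit \<Rightarrow> 'a set" +
  fixes bracket :: "'a \<Rightarrow> 'a \<Rightarrow> 'a"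
  assumes linear_left: "Vector_Spaces.linear scale scale (\<lambda>a. bracket a b)"
    and linear_right: "Vector_Spaces.linear scale scale (\<lambda>b. bracket a b)"
    and bracket_grade: "a \<in> grade p \<Longrightarrow> b \<in> grade q \<Longrightarrow> bracket a b \<in> grade (p + q)"
    and bracket_antisym: "a \<in> grade p \<Longrightarrow> b \<in> grade q \<Longrightarrow>
      bracket a b = - scale (parity_sign p q) (bracket b a)"
    and bracket_jacobi: "a \<in> grade p \<Longrightarrow> b \<in> grade q \<Longrightarrow>
      bracket a (bracket b c) =
        bracket (bracket a b) c + scale (parity_sign p q) (bracket b (bracket a c))"

definition derived_bracket :: "('a \<Rightarrow> 'a) \<Rightarrow> ('a \<Rightarrow> 'a \<Rightarrow> 'a) \<Rightarrow> 'a \<Rightarrow> 'a list \<Rightarrow> 'a"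
  where "derived_bracket P bracket E as = P (foldl bracket E as)"

lemma (in lie_superalgebra) derived_bracket_zero:
  assumes P: "Vector_Spaces.linear scale scale P" and z: "0 \<in> set as"
  shows "derived_bracket P bracket E as = 0"
proof -
  have l: "bracket 0 b = 0" and r: "bracket a 0 = 0" and P0: "P 0 = 0" for a b
    using module_hom.zero [OF linear_left [THEN Vector_Spaces.module_hom_linearI], of b]
      module_hom.zero [OF linear_right [THEN Vector_Spaces.module_hom_linearI], of a]
      module_hom.zero [OF P [THEN Vector_Spaces.module_hom_linearI]] by simp_all
  have z0: "foldl bracket 0 xs = 0" for xs by (induction xs) (auto simp: l)
  have "foldl bracket E as = 0" using z by (induction as arbitrary: E) (auto simp: r z0)
  then show ?thesis by (simp add: derived_bracket_def P0)
qed

end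

theory Submission
  imports Defs
begin

text \<open>
  The square \<open>[\<Delta>, \<Delta>]\<close> is a bracket of two copies of \<open>\<Delta>\<close>, and bracketing with an element from the
  right is a superderivation. Hence \<open>[\<dots>[[\<Delta>, \<Delta>], a\<^sub>1], \<dots>, a\<^sub>n]\<close> is a signed sum, over all ways of
  distributing the \<open>a\<^sub>i\<close> between the two copies, of brackets \<open>[\<Delta>\<^sub>S, \<Delta>\<^sub>T]\<close>, where \<open>T\<close> is the complement
  of \<open>S\<close> and \<open>\<Delta>\<^sub>S\<close> is the iterated bracket of \<open>\<Delta>\<close> with the \<open>a\<^sub>i\<close> for \<open>i \<in> S\<close>
  (\<open>foldl_bracket_Leibniz\<close>).

  Apply \<open>P\<close>. The rule for \<open>P[a, b]\<close> splits each summand into \<open>P[P\<Delta>\<^sub>S, \<Delta>\<^sub>T]\<close> and \<open>P[\<Delta>\<^sub>S, P\<Delta>\<^sub>T]\<close>.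
  By antisymmetry, the second kind of term for \<open>S\<close> is the first kind for \<open>T\<close>, sign included, so the
  two sums are equal. This doubling cancels the factor \<open>1/2\<close> in \<open>\<Delta>\<^sup>2\<close>.

  It remains to recognise \<open>P[P\<Delta>\<^sub>S, \<Delta>\<^sub>T]\<close> as a nested derived bracket. The element \<open>b = P\<Delta>\<^sub>S\<close> lies in
  the abelian subalgebra \<open>V = P(L)\<close>, as do the \<open>a\<^sub>i\<close>, so \<open>[b, _]\<close> commutes with all brackets by the
  \<open>a\<^sub>i\<close> (\<open>foldl_bracket_range_left\<close>). Up to the sign of exchanging \<open>b\<close> with \<open>\<Delta>\<close>, this gives
  \<open>{b, a\<^sub>T}\<^sub>\<Delta>\<close>, with \<open>b\<close> the inner bracket \<open>{a\<^sub>S}\<^sub>\<Delta>\<close>. That sign cancels the one from moving the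
  \<open>a\<^sub>i\<close>, \<open>i \<in> S\<close>, past the second \<open>\<Delta>\<close>, and what remains is the Koszul sign of moving \<open>a\<^sub>S\<close> in front
  of \<open>a\<^sub>T\<close>.

  Shuffles enter only through the set of positions they move to the front. Replacing them by subsets
  (\<open>homogeneous_jacobiator_eq_sum_subsets\<close>) makes the expansion an induction on the list of
  arguments, and turns the symmetry above into complementation. Arguments that are not homogeneous
  are treated by multilinearity, since \<open>V\<close> contains the homogeneous components of its elements.
\<close>

section \<open>Parity signs and the sign of a splitting\<close>

lemma parity_sign_add_left:
  "parity_sign (p + q) r = parity_sign p r * (parity_sign q r :: 'k::comm_ring_1)"
  by (cases p; cases q; cases r) (simp_all add: parity_sign_def)

lemma parity_sign_add_right:
  "parity_sign r (p + q) = parity_sign r p * (parity_sign r q :: 'k::comm_ring_1)"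
  by (simp only: parity_sign_commute [of r] parity_sign_add_left)

lemma parity_sign_0 [simp]:
  "parity_sign 0 r = (1 :: 'k::comm_ring_1)" "parity_sign r 0 = (1 :: 'k::comm_ring_1)"
  by (simp_all add: parity_sign_def)

lemma parity_sign_one_one [simp]: "parity_sign 1 1 = (- 1 :: 'k::comm_ring_1)"
  by (simp add: parity_sign_def)

text \<open>
  Sums of parities have to stay sums for the two additivity lemmas to apply. The removed rule turns
  them into case distinctions on evenness.
\<close>

declare add_bit_eq_xor [simp del]

lemma parity_sign_square_left [simp]:
  "parity_sign p q * (parity_sign p q * c) = (c :: 'k::comm_ring_1)"
  by (simp add: parity_sign_square flip: mult.assoc)

lemma prod_parity_sign:
  "finite A \<Longrightarrow>
    (\<Prod>i\<in>A. parity_sign (f i) r) = (parity_sign (\<Sum>i\<in>A. f i) r :: 'k::comm_ring_1)"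
  by (induction A rule: finite_induct) (simp_all add: parity_sign_add_left)

lemma nths_restrict: "nths xs (A \<inter> {..<length xs}) = nths xs A"
  unfolding nths_def by (intro arg_cong [where f = "map fst"] filter_cong) (auto simp: set_zip)

lemma nths_cong: "A \<inter> {..<length xs} = B \<inter> {..<length xs} \<Longrightarrow> nths xs A = nths xs B"
  by (metis nths_restrict)

lemma nths_insert_length: "nths xs (insert (length xs) A) = nths xs A"
  by (rule nths_cong) auto

lemma nths_minus_insert_length: "nths xs (- insert (length xs) A) = nths xs (- A)"
  by (rule nths_cong) auto

lemma nths_snoc: "nths (xs @ [x]) A = nths xs A @ (if length xs \<in> A then [x] else [])"
  by (simp add: nths_append)

lemma sum_list_nths:
  "sum_list (nths xs A) = (\<Sum>i\<in>{..<length xs} \<inter> A. xs ! i :: 'a::comm_monoid_add)"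
proof (induction xs rule: rev_induct)
  case (snoc x xs)
  have "{..<length (xs @ [x])} \<inter> A =
      (if length xs \<in> A then insert (length xs) ({..<length xs} \<inter> A) else {..<length xs} \<inter> A)"
    by (auto simp: less_Suc_eq)
  moreover have "(\<Sum>i\<in>{..<length xs} \<inter> A. (xs @ [x]) ! i) = (\<Sum>i\<in>{..<length xs} \<inter> A. xs ! i)"
    by (rule sum.cong) (auto simp: nth_append)
  ultimately show ?case using snoc by (auto simp: nths_snoc add.commute)
qed simp

text \<open>
  This is the Koszul sign of moving the entries at the positions in \<open>S\<close> to the front, without
  changing the order inside \<open>S\<close> or outside it: an entry in \<open>S\<close> passes exactly the earlier entries
  outside \<open>S\<close>. Positions beyond the end of the list are ignored, so \<open>- S\<close> can serve as the
  complement of \<open>S\<close>.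
\<close>

definition unshuffle_sign :: "bit list \<Rightarrow> nat set \<Rightarrow> 'k::comm_ring_1"
  where "unshuffle_sign ps S =
    (\<Prod>j \<in> {..<length ps} \<inter> S. \<Prod>i \<in> {..<j} - S. parity_sign (ps ! i) (ps ! j))"

lemma unshuffle_sign_Nil [simp]: "unshuffle_sign [] S = (1 :: 'k::comm_ring_1)"
  by (simp add: unshuffle_sign_def)

lemma unshuffle_sign_restrict:
  "unshuffle_sign ps (S \<inter> {..<length ps}) = (unshuffle_sign ps S :: 'k::comm_ring_1)"
  unfolding unshuffle_sign_def by (intro prod.cong) auto

lemma unshuffle_sign_cong:
  "S \<inter> {..<length ps} = T \<inter> {..<length ps} \<Longrightarrow>
    unshuffle_sign ps S = (unshuffle_sign ps T :: 'k::comm_ring_1)"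
  by (metis unshuffle_sign_restrict)

text \<open>
  A new last entry is passed by nothing, and if it belongs to \<open>S\<close> it passes everything outside
  \<open>S\<close>. This recursion matches the outermost bracket of an iterated bracket.
\<close>

lemma unshuffle_sign_snoc:
  "unshuffle_sign (ps @ [p]) S =
    (unshuffle_sign ps S * (if length ps \<in> S then parity_sign (sum_list (nths ps (- S))) p else 1)
      :: 'k::comm_ring_1)"
proof -
  let ?n = "length ps"
  have rng: "{..<length (ps @ [p])} \<inter> S =
      (if ?n \<in> S then insert ?n ({..<?n} \<inter> S) else {..<?n} \<inter> S)"
    by (auto simp: less_Suc_eq)
  have old: "(\<Prod>j \<in> {..<?n} \<inter> S. \<Prod>i \<in> {..<j} - S. parity_sign ((ps @ [p]) ! i) ((ps @ [p]) ! j))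
      = (unshuffle_sign ps S :: 'k)"
    unfolding unshuffle_sign_def by (intro prod.cong refl) (auto simp: nth_append)
  have "(\<Prod>i \<in> {..<?n} - S. parity_sign ((ps @ [p]) ! i) p)
      = (\<Prod>i \<in> {..<?n} \<inter> - S. parity_sign (ps ! i) p :: 'k)"
    by (intro prod.cong) (auto simp: nth_append)
  also have "\<dots> = parity_sign (sum_list (nths ps (- S))) p"
    by (simp add: prod_parity_sign sum_list_nths)
  finally show ?thesis
    unfolding unshuffle_sign_def [of "ps @ [p]"] rng using old by (simp add: mult.commute)
qed

text \<open>
  Moving the complement of \<open>S\<close> to the front amounts to moving \<open>S\<close> to the front and then exchanging
  the two blocks.
\<close>

lemma unshuffle_sign_Compl:
  "unshuffle_sign ps (- S) =
    (unshuffle_sign ps S * parity_sign (sum_list (nths ps S)) (sum_list (nths ps (- S)))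
      :: 'k::comm_ring_1)"
proof (induction ps rule: rev_induct)
  case (snoc p ps)
  then show ?case
    by (simp add: unshuffle_sign_snoc nths_snoc parity_sign_add_left parity_sign_add_right
        parity_sign_commute [of p] mult_ac parity_sign_square)
qed simp

section \<open>Shuffles as subsets of positions\<close>

lemma set_nths_upt: "set (nths [0..<n] S) = {..<n} \<inter> S"
  by (auto simp: set_nths) (metis add_0 nth_upt)

text \<open>
  Both sides are increasing lists with the same set of entries. So the values of a shuffle on each of
  its two blocks are determined by the image of that block.
\<close>

lemma map_eq_nths_upt:
  assumes mono: "strict_mono_on {a..<b} \<sigma>" and img: "\<sigma> ` {a..<b} = {..<n} \<inter> S"
  shows "map \<sigma> [a..<b] = nths [0..<n] S"
proof -
  have "sorted_wrt (<) (map \<sigma> [a..<b])"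
    by (auto simp: sorted_wrt_iff_nth_less intro!: strict_mono_onD [OF mono])
  then have "sorted (map \<sigma> [a..<b])" "distinct (map \<sigma> [a..<b])"
    by (simp_all only: strict_sorted_iff)
  then show ?thesis
    by (intro sorted_distinct_set_unique) (auto simp: img set_nths_upt sorted_nths)
qed

lemma shuffle_permsD:
  assumes "\<sigma> \<in> shuffle_perms k l"
  shows shuffle_perms_permutes: "\<sigma> permutes {..<k + l}"
    and shuffle_perms_front: "map \<sigma> [0..<k] = nths [0..<k + l] (\<sigma> ` {..<k})"
    and shuffle_perms_rest: "map \<sigma> [k..<k + l] = nths [0..<k + l] (- \<sigma> ` {..<k})"
proof -
  show \<sigma>: "\<sigma> permutes {..<k + l}" using assms by (simp add: shuffle_perms_def)
  have front: "strict_mono_on {0..<k} \<sigma>" and rest: "strict_mono_on {k..<k + l} \<sigma>"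
    using assms by (simp_all add: shuffle_perms_def atLeast0LessThan)
  have img: "\<sigma> ` {..<k + l} = {..<k + l}" using \<sigma> by (rule permutes_image)
  have split: "{k..<k + l} = {..<k + l} - {..<k}" by auto
  show "map \<sigma> [0..<k] = nths [0..<k + l] (\<sigma> ` {..<k})"
    using img by (intro map_eq_nths_upt front) (auto simp: atLeast0LessThan)
  show "map \<sigma> [k..<k + l] = nths [0..<k + l] (- \<sigma> ` {..<k})"
  proof (rule map_eq_nths_upt [OF rest])
    have "\<sigma> ` {k..<k + l} = \<sigma> ` {..<k + l} - \<sigma> ` {..<k}"
      unfolding split by (rule image_set_diff [OF permutes_inj [OF \<sigma>]])
    then show "\<sigma> ` {k..<k + l} = {..<k + l} \<inter> - \<sigma> ` {..<k}"
      by (simp only: img Diff_eq)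
  qed
qed

text \<open>
  The witness lists the positions in \<open>S\<close> in increasing order and then the others in increasing order.
\<close>

lemma shuffle_perms_exists:
  assumes S: "S \<subseteq> {..<n}"
  shows "\<exists>k l \<sigma>. k + l = n \<and> \<sigma> \<in> shuffle_perms k l \<and> \<sigma> ` {..<k} = S"
proof -
  define front where "front = nths [0..<n] S"
  define rest where "rest = nths [0..<n] (- S)"
  define xs where "xs = front @ rest"
  define \<sigma> where "\<sigma> i = (if i < n then xs ! i else i)" for i
  let ?k = "length front" and ?l = "length rest"
  have sets: "set front = S" "set rest = {..<n} - S"
    using S by (auto simp: front_def rest_def set_nths_upt)
  have dist: "distinct xs" using sets by (auto simp: xs_def front_def rest_def)
  have set_xs: "set xs = {..<n}" using S sets by (auto simp: xs_def)
  have len: "length xs = n" using distinct_card [OF dist] set_xs by simp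
  then have kl: "?k + ?l = n" by (simp add: xs_def)
  have "bij_betw ((!) xs) {..<n} {..<n}"
    using bij_betw_nth [OF dist] len set_xs by blast
  then have "bij_betw \<sigma> {..<n} {..<n}"
    by (rule bij_betw_cong [THEN iffD1, rotated]) (simp add: \<sigma>_def)
  then have perm: "\<sigma> permutes {..<n}" by (rule bij_imp_permutes) (simp add: \<sigma>_def)
  have sorted: "sorted_wrt (<) front" "sorted_wrt (<) rest"
    by (simp_all add: front_def rest_def strict_sorted_iff sorted_nths)
  have "strict_mono_on {..<?k} \<sigma>"
    using sorted(1) kl
    by (auto simp: strict_mono_on_def \<sigma>_def xs_def nth_append sorted_wrt_iff_nth_less)
  moreover have "strict_mono_on {?k..<?k + ?l} \<sigma>"
    using sorted(2) kl
    by (auto simp: strict_mono_on_def \<sigma>_def xs_def nth_append sorted_wrt_iff_nth_less)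
  ultimately have "\<sigma> \<in> shuffle_perms ?k ?l" using perm kl by (simp add: shuffle_perms_def)
  moreover have "\<sigma> ` {..<?k} = set front"
    unfolding set_conv_nth using kl by (auto simp: \<sigma>_def xs_def nth_append image_iff)
  ultimately show ?thesis using kl sets by blast
qed

lemma bij_betw_shuffles_subsets:
  "bij_betw (\<lambda>((k, l), \<sigma>). \<sigma> ` {..<k})
    (SIGMA (k, l) : {(k, l). k + l = n}. shuffle_perms k l) (Pow {..<n})"
  unfolding bij_betw_def
proof
  let ?D = "SIGMA (k, l) : {(k, l). k + l = n}. shuffle_perms k l"
  let ?f = "\<lambda>((k, l), \<sigma>). \<sigma> ` {..<k}"
  show "inj_on ?f ?D"
  proof (rule inj_onI, clarsimp)
    fix k l \<sigma> k' l' \<sigma>'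
    assume n': "k' + l' = k + l" and \<sigma>: "\<sigma> \<in> shuffle_perms k l" and \<sigma>': "\<sigma>' \<in> shuffle_perms k' l'"
      and eq: "\<sigma> ` {..<k} = \<sigma>' ` {..<k'}" and "n = k + l"
    have front: "map \<sigma> [0..<k] = map \<sigma>' [0..<k']"
      using shuffle_perms_front [OF \<sigma>] shuffle_perms_front [OF \<sigma>'] n' eq by simp
    then have k: "k = k'" by (metis length_map length_upt diff_zero)
    have rest: "map \<sigma> [k..<k + l] = map \<sigma>' [k..<k + l]"
      using shuffle_perms_rest [OF \<sigma>] shuffle_perms_rest [OF \<sigma>'] n' eq k by simp
    have "\<sigma> i = \<sigma>' i" for i
    proof -
      consider "i < k" | "k \<le> i" "i < k + l" | "i \<notin> {..<k + l}" by fastforce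
      then show ?thesis
      proof cases
        case 1
        then show ?thesis using front k by simp
      next
        case 2
        then show ?thesis using rest by simp
      next
        case 3
        then show ?thesis
          using permutes_not_in [OF shuffle_perms_permutes [OF \<sigma>]]
            permutes_not_in [OF shuffle_perms_permutes [OF \<sigma>']] n' by simp
      qed
    qed
    then show "k = k' \<and> l = l' \<and> \<sigma> = \<sigma>'" using k n' by auto
  qed
  show "?f ` ?D = Pow {..<n}"
  proof (intro equalityI subsetI)
    fix S assume "S \<in> ?f ` ?D"
    then show "S \<in> Pow {..<n}"
      using permutes_in_image [OF shuffle_perms_permutes] by (fastforce simp: image_iff)
  next
    fix S assume "S \<in> Pow {..<n}"
    then obtain k l \<sigma> where "k + l = n" "\<sigma> \<in> shuffle_perms k l" "\<sigma> ` {..<k} = S"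
      using shuffle_perms_exists [of S n] by auto
    then have "((k, l), \<sigma>) \<in> ?D" "S = ?f ((k, l), \<sigma>)" by auto
    then show "S \<in> ?f ` ?D" by (rule rev_image_eqI)
  qed
qed

text \<open>
  A shuffle is increasing on each block, so an inverted pair consists of one position in each block;
  its values are an element of \<open>\<sigma> ` {..<k}\<close> and a smaller number outside that set. These are the pairs
  that \<open>unshuffle_sign\<close> counts.
\<close>

lemma koszul_sign_shuffle:
  assumes \<sigma>: "\<sigma> \<in> shuffle_perms k l" and n: "length ps = k + l"
  shows "koszul_sign ps \<sigma> = (unshuffle_sign ps (\<sigma> ` {..<k}) :: 'k::comm_ring_1)"
proof -
  let ?S = "\<sigma> ` {..<k}" and ?n = "k + l"
  let ?A = "{(i, j). i < j \<and> j < ?n \<and> \<sigma> j < \<sigma> i}"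
  let ?B = "SIGMA v : {..<?n} \<inter> ?S. {..<v} - ?S"
  have perm: "\<sigma> permutes {..<?n}" by (rule shuffle_perms_permutes [OF \<sigma>])
  have inv: "inv \<sigma> (\<sigma> i) = i" "\<sigma> (inv \<sigma> i) = i" for i
    using permutes_inverses [OF perm] by auto
  have lt: "\<sigma> i < ?n \<longleftrightarrow> i < ?n" for i using permutes_in_image [OF perm, of i] by simp
  have mem: "\<sigma> i \<in> ?S \<longleftrightarrow> i < k" for i using inv by (metis imageE imageI lessThan_iff)
  have mono: "\<sigma> i < \<sigma> j" if "i < j" "j < k \<or> k \<le> i \<and> j < ?n" for i j
    using \<sigma> that by (auto simp: shuffle_perms_def strict_mono_on_def)
  have pos: "i < k \<and> k \<le> j" if "i < j" "j < ?n" "\<sigma> j < \<sigma> i" for i j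
    using mono [of i j] that by (meson linorder_not_less order.asym)
  have "koszul_sign ps \<sigma> = (\<Prod>(i, j) \<in> ?A. parity_sign (ps ! \<sigma> i) (ps ! \<sigma> j) :: 'k)"
    by (simp only: koszul_sign_def n)
  also have "\<dots> = (\<Prod>(v, u) \<in> ?B. parity_sign (ps ! u) (ps ! v))"
  proof (rule prod.reindex_bij_witness
      [of _ "\<lambda>(v, u). (inv \<sigma> v, inv \<sigma> u)" "\<lambda>(i, j). (\<sigma> i, \<sigma> j)"], goal_cases)
    case (2 x)
    then obtain i j where x: "x = (i, j)" and ij: "i < j" "j < ?n" "\<sigma> j < \<sigma> i" by auto
    then show ?case using pos [OF ij] by (simp add: mem lt)
  next
    case (4 y)
    then obtain v u where y: "y = (v, u)" and vu: "v < ?n" "v \<in> ?S" "u < v" "u \<notin> ?S" by auto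
    have "inv \<sigma> v < k" "\<not> inv \<sigma> u < k" "inv \<sigma> u < ?n"
      using vu mem [of "inv \<sigma> v"] mem [of "inv \<sigma> u"] lt [of "inv \<sigma> u"] inv by auto
    then show ?case using vu inv y by auto
  qed (auto simp: inv parity_sign_commute)
  also have "\<dots> = unshuffle_sign ps ?S"
    unfolding unshuffle_sign_def n by (subst prod.Sigma) auto
  finally show ?thesis .
qed

lemma nths_conv_map_upt: "nths xs S = map ((!) xs) (nths [0..<length xs] S)"
  by (simp add: map_nth flip: nths_map)

lemma (in super_space) homogeneous_jacobiator_eq_sum_subsets:
  assumes len: "length ps = length as"
  shows "homogeneous_jacobiator B ps as =
    (\<Sum>S \<in> Pow {..<length as}. scale (unshuffle_sign ps S) (B (B (nths as S) # nths as (- S))))"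
proof -
  let ?n = "length as"
  let ?K = "{(k, l). k + l = ?n}"
  let ?G = "\<lambda>S. scale (unshuffle_sign ps S) (B (B (nths as S) # nths as (- S)))"
  have term_eq: "scale (koszul_sign ps \<sigma>)
        (B (B (map (\<lambda>i. as ! \<sigma> i) [0..<k]) # map (\<lambda>i. as ! \<sigma> i) [k..<k + l])) = ?G (\<sigma> ` {..<k})"
    if "k + l = ?n" "\<sigma> \<in> shuffle_perms k l" for k l \<sigma>
  proof -
    have "map (\<lambda>i. as ! \<sigma> i) xs = map ((!) as) (map \<sigma> xs)" for xs by simp
    then show ?thesis
      using that(2) len by (simp only: shuffle_perms_front shuffle_perms_rest koszul_sign_shuffle
          nths_conv_map_upt [of as] that(1) [symmetric])
  qed
  have finK: "finite ?K"
    by (rule finite_subset [of _ "{..?n} \<times> {..?n}"]) auto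
  have fin: "finite (shuffle_perms k l)" for k l
    by (rule finite_subset [OF _ finite_permutations [of "{..<k + l}"]])
      (auto simp: shuffle_perms_def)
  have "homogeneous_jacobiator B ps as =
      (\<Sum>(k, l) \<in> ?K. \<Sum>\<sigma> \<in> shuffle_perms k l. ?G (\<sigma> ` {..<k}))"
    unfolding homogeneous_jacobiator_def using term_eq by (auto intro!: sum.cong)
  also have "\<dots> = (\<Sum>x \<in> ?K. \<Sum>\<sigma> \<in> (case x of (k, l) \<Rightarrow> shuffle_perms k l). ?G (\<sigma> ` {..<fst x}))"
    by (intro sum.cong) auto
  also have "\<dots> = (\<Sum>(x, \<sigma>) \<in> (SIGMA (k, l) : ?K. shuffle_perms k l). ?G (\<sigma> ` {..<fst x}))"
    by (rule sum.Sigma) (use finK fin in auto)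
  also have "\<dots> = (\<Sum>x \<in> (SIGMA (k, l) : ?K. shuffle_perms k l).
      ?G ((\<lambda>((k, l), \<sigma>). \<sigma> ` {..<k}) x))"
    by (intro sum.cong) auto
  also have "\<dots> = (\<Sum>S \<in> Pow {..<?n}. ?G S)"
    by (rule sum.reindex_bij_betw [OF bij_betw_shuffles_subsets])
  finally show ?thesis .
qed

section \<open>Iterated brackets in a Lie superalgebra\<close>

lemma sum_Pow_lessThan_Suc:
  "(\<Sum>S \<in> Pow {..<Suc n}. f S) = (\<Sum>S \<in> Pow {..<n}. f S + f (insert n S) :: 'a::comm_monoid_add)"
proof -
  have inj: "inj_on (insert n) (Pow {..<n})" 
    by (rule inj_onI) (metis Pow_iff insert_ident lessThan_iff less_irrefl subsetD)
  have "(\<Sum>S \<in> Pow {..<Suc n}. f S) = (\<Sum>S \<in> Pow {..<n}. f S) + (\<Sum>S \<in> insert n ` Pow {..<n}. f S)"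
    unfolding lessThan_Suc Pow_insert by (rule sum.union_disjoint) auto
  then show ?thesis by (simp add: sum.reindex [OF inj] sum.distrib)
qed

lemma sum_length_Suc_bit:
  "(\<Sum>ps \<in> {ps :: bit list. length ps = Suc n}. f ps) =
    (\<Sum>ps \<in> {ps. length ps = n}. f (0 # ps) + f (1 # ps) :: 'a::comm_monoid_add)"
proof -
  have UB: "(UNIV :: bit set) = {0, 1}" using bit_not_zero_iff by blast
  have "finite (UNIV :: bit set)" unfolding UB by simp
  then have fin: "finite {ps :: bit list. length ps = n}"
    using finite_lists_length_eq [of "UNIV :: bit set" n] by simp
  have "{ps :: bit list. length ps = Suc n} =
      (#) 0 ` {ps. length ps = n} \<union> (#) 1 ` {ps. length ps = n}"
    by (auto simp: length_Suc_conv image_iff)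
  then have "(\<Sum>ps \<in> {ps :: bit list. length ps = Suc n}. f ps) =
      (\<Sum>ps \<in> (#) 0 ` {ps. length ps = n}. f ps) + (\<Sum>ps \<in> (#) 1 ` {ps. length ps = n}. f ps)"
    by (simp only:) (rule sum.union_disjoint; use fin in auto)
  then show ?thesis by (simp add: sum.reindex sum.distrib)
qed

context lie_superalgebra
begin

lemma bracket_add_left: "bracket (a + a') b = bracket a b + bracket a' b"
  and bracket_scale_left: "bracket (scale c a) b = scale c (bracket a b)"
  and bracket_add_right: "bracket a (b + b') = bracket a b + bracket a b'"
  and bracket_sum_left: "bracket (\<Sum>x\<in>A. f x) b = (\<Sum>x\<in>A. bracket (f x) b)"
proof -
  note left = linear_left [THEN Vector_Spaces.module_hom_linearI]
    and right = linear_right [THEN Vector_Spaces.module_hom_linearI]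
  show "bracket (a + a') b = bracket a b + bracket a' b" by (rule module_hom.add [OF left])
  show "bracket (scale c a) b = scale c (bracket a b)" by (rule module_hom.scale [OF left])
  show "bracket a (b + b') = bracket a b + bracket a b'" by (rule module_hom.add [OF right])
  show "bracket (\<Sum>x\<in>A. f x) b = (\<Sum>x\<in>A. bracket (f x) b)" by (rule module_hom.sum [OF left])
qed

lemma foldl_bracket_add:
  "foldl bracket (a + b) as = foldl bracket a as + foldl bracket b as"
  by (induction as arbitrary: a b) (simp_all add: bracket_add_left)

lemma foldl_bracket_scale: "foldl bracket (scale c a) as = scale c (foldl bracket a as)"
  by (induction as arbitrary: a) (simp_all add: bracket_scale_left)

lemma foldl_bracket_components:
  "foldl bracket E as =
    (\<Sum>ps \<in> {ps. length ps = length as}. foldl bracket E (map2 component ps as))"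
proof (induction as arbitrary: E)
  case (Cons a as)
  have "foldl bracket E (a # as) =
      foldl bracket (bracket E (component 0 a)) as + foldl bracket (bracket E (component 1 a)) as"
    by (simp add: component_sum flip: foldl_bracket_add bracket_add_right)
  then show ?case
    by (simp add: sum_length_Suc_bit sum.distrib
        Cons.IH [of "bracket E (component 0 a)"] Cons.IH [of "bracket E (component 1 a)"])
qed simp

text \<open>
  The Jacobi identity, rearranged with antisymmetry: bracketing with \<open>a\<close> from the right is a
  superderivation acting from the right.
\<close>

lemma bracket_bracket_right:
  assumes "x \<in> grade p" "y \<in> grade q" "a \<in> grade r"
  shows "bracket (bracket x y) a =
    bracket x (bracket y a) + scale (parity_sign q r) (bracket (bracket x a) y)"
proof -
  have "bracket y (bracket x a) = - scale (parity_sign q (p + r)) (bracket (bracket x a) y)"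
    using assms by (intro bracket_antisym bracket_grade)
  then have "bracket x (bracket y a) = bracket (bracket x y) a
      - scale (parity_sign p q * parity_sign q (p + r)) (bracket (bracket x a) y)"
    using bracket_jacobi [OF assms(1,2), of a] by simp
  also have "parity_sign p q * parity_sign q (p + r) = (parity_sign q r :: 'k)"
    by (simp add: parity_sign_add_right parity_sign_commute [of p])
  finally show ?thesis by simp
qed

lemma foldl_bracket_grade:
  assumes "x \<in> grade p" "list_all2 (\<lambda>r a. a \<in> grade r) ps as"
  shows "foldl bracket x as \<in> grade (p + sum_list ps)"
  using assms(2,1)
proof (induction arbitrary: x p rule: list_all2_induct)
  case (Cons r rs a as)
  then show ?case using Cons.IH [OF bracket_grade [OF Cons.prems Cons.hyps(1)]]
    by (simp add: add.assoc)
qed simp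

lemma list_all2_nths: "list_all2 R xs ys \<Longrightarrow> list_all2 R (nths xs S) (nths ys S)"
  by (induction arbitrary: S rule: list_all2_induct) (simp_all add: nths_Cons list_all2_appendI)

text \<open>
  The superderivation property iterated over the list: each argument goes either to \<open>x\<close> or to \<open>y\<close>,
  and \<open>S\<close> collects the positions that go to \<open>x\<close>. An argument going to \<open>x\<close> passes \<open>y\<close>, which gives the
  factor \<open>parity_sign\<close>, and the earlier arguments attached to \<open>y\<close>, which give \<open>unshuffle_sign\<close>.
\<close>

lemma foldl_bracket_Leibniz:
  assumes x: "x \<in> grade p" and y: "y \<in> grade q"
    and as: "list_all2 (\<lambda>r a. a \<in> grade r) ps as"
  shows "foldl bracket (bracket x y) as =
    (\<Sum>S \<in> Pow {..<length as}.
      scale (unshuffle_sign ps S * parity_sign q (sum_list (nths ps S)))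
        (bracket (foldl bracket x (nths as S)) (foldl bracket y (nths as (- S)))))"
  using as
proof (induction as arbitrary: ps rule: rev_induct)
  case (snoc a as)
  then obtain rs r where ps: "ps = rs @ [r]" and rs: "list_all2 (\<lambda>r a. a \<in> grade r) rs as"
    and a: "a \<in> grade r"
    by (auto simp: list_all2_append2 list_all2_Cons2 dest: list_all2_lengthD)
  have len: "length rs = length as" using rs by (rule list_all2_lengthD)
  let ?n = "length as"
  let ?X = "\<lambda>S. foldl bracket x (nths as S)" and ?Y = "\<lambda>S. foldl bracket y (nths as (- S))"
  let ?c = "\<lambda>S. unshuffle_sign rs S * parity_sign q (sum_list (nths rs S))"
  let ?F = "\<lambda>S. scale (unshuffle_sign ps S * parity_sign q (sum_list (nths ps S)))
        (bracket (foldl bracket x (nths (as @ [a]) S)) (foldl bracket y (nths (as @ [a]) (- S))))"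
  \<comment> \<open>The two terms of the derivation rule: the last argument goes to \<open>y\<close>, or it goes to \<open>x\<close>.\<close>
  have step: "bracket (scale (?c S) (bracket (?X S) (?Y S))) a = ?F S + ?F (insert ?n S)"
    if "S \<in> Pow {..<?n}" for S
  proof -
    have n: "?n \<notin> S" using that by auto
    have X: "?X S \<in> grade (p + sum_list (nths rs S))"
      by (intro foldl_bracket_grade x list_all2_nths rs)
    have Y: "?Y S \<in> grade (q + sum_list (nths rs (- S)))"
      by (intro foldl_bracket_grade y list_all2_nths rs)
    have sign: "unshuffle_sign rs (insert ?n S) = (unshuffle_sign rs S :: 'k)"
      by (rule unshuffle_sign_cong) (auto simp: len)
    have "?F S = scale (?c S) (bracket (?X S) (bracket (?Y S) a))"
      using n by (simp add: ps unshuffle_sign_snoc nths_snoc len)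
    moreover have "unshuffle_sign ps (insert ?n S) * parity_sign q (sum_list (nths ps (insert ?n S)))
        = (?c S * parity_sign (q + sum_list (nths rs (- S))) r :: 'k)"
    proof -
      have "nths ps (insert ?n S) = nths rs S @ [r]"
        using nths_insert_length [of rs S] by (simp add: ps nths_snoc len)
      moreover have "unshuffle_sign ps (insert ?n S) =
          (unshuffle_sign rs S * parity_sign (sum_list (nths rs (- S))) r :: 'k)"
        using nths_minus_insert_length [of rs S] by (simp add: ps unshuffle_sign_snoc len sign)
      ultimately show ?thesis
        by (simp only: sum_list_append sum_list.Cons sum_list.Nil add_0_right
            parity_sign_add_left parity_sign_add_right mult_ac)
    qed
    then have "?F (insert ?n S) =
        scale (?c S * parity_sign (q + sum_list (nths rs (- S))) r) (bracket (bracket (?X S) a) (?Y S))"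
      using nths_insert_length [of as S] nths_minus_insert_length [of as S]
      by (simp add: nths_snoc)
    ultimately show ?thesis
      by (simp add: bracket_scale_left bracket_bracket_right [OF X Y a] scale_right_distrib)
  qed
  show ?case
    by (simp add: snoc.IH [OF rs] bracket_sum_left sum_Pow_lessThan_Suc step)
qed simp

end

section \<open>The Jacobiator of the derived brackets\<close>

locale lie_superalgebra_projection = lie_superalgebra scale grade bracket
  for scale :: "'k::field_char_0 \<Rightarrow> 'a::ab_group_add \<Rightarrow> 'a"
    and grade :: "bit \<Rightarrow> 'a set"
    and bracket :: "'a \<Rightarrow> 'a \<Rightarrow> 'a" +
  fixes P :: "'a \<Rightarrow> 'a"
  assumes linear_P: "Vector_Spaces.linear scale scale P"
    and P_grade: "a \<in> grade p \<Longrightarrow> P a \<in> grade p"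
    and P_idem: "P (P a) = P a"
    and P_abelian: "bracket (P a) (P b) = 0"
    and P_bracket: "P (bracket a b) = P (bracket (P a) b) + P (bracket a (P b))"
begin

lemma P_sum: "P (\<Sum>x\<in>A. f x) = (\<Sum>x\<in>A. P (f x))"
  and P_scale: "P (scale c a) = scale c (P a)"
  and P_minus: "P (- a) = - P a"
  and P_add: "P (a + b) = P a + P b"
proof -
  note hom = linear_P [THEN Vector_Spaces.module_hom_linearI]
  show "P (\<Sum>x\<in>A. f x) = (\<Sum>x\<in>A. P (f x))" by (rule module_hom.sum [OF hom])
  show "P (scale c a) = scale c (P a)" by (rule module_hom.scale [OF hom])
  show "P (- a) = - P a" by (rule module_hom.neg [OF hom])
  show "P (a + b) = P a + P b" by (rule module_hom.add [OF hom])
qed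

text \<open>
  An even projection commutes with taking homogeneous components, so its range is a graded subspace.
\<close>

lemma component_in_range: "a \<in> range P \<Longrightarrow> component p a \<in> range P"
proof -
  assume "a \<in> range P"
  then have a: "P a = a" using P_idem by auto
  have "component p a + component (p + 1) a = a"
    using component_sum [of a] by (cases p) (simp_all add: add.commute)
  then have d: "a - component p a = component (p + 1) a" by (metis add_diff_cancel_left')
  have "component p a = P (component p a)"
  proof (rule component_unique)
    show "P (component p a) \<in> grade p" by (intro P_grade component_in_grade)
    have "a - P (component p a) = P (component (p + 1) a)"
      using d a by (metis P_add add_diff_cancel_left' diff_add_cancel add.commute)
    then show "a - P (component p a) \<in> grade (p + 1)" by (simp add: P_grade component_in_grade)
  qed
  then show ?thesis by (metis rangeI)
qed

text \<open>
  In \<open>[[b, x], a] = [b, [x, a]] \<plusminus> [[b, a], x]\<close> the last term vanishes because \<open>P(L)\<close> is abelian.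
\<close>

lemma foldl_bracket_range_left:
  assumes b: "b \<in> range P" "b \<in> grade p" and x: "x \<in> grade q"
    and as: "list_all2 (\<lambda>r a. a \<in> grade r) ps as" "set as \<subseteq> range P"
  shows "foldl bracket (bracket b x) as = bracket b (foldl bracket x as)"
  using as x
proof (induction arbitrary: x q rule: list_all2_induct)
  case (Cons r rs a as)
  have "bracket b a = 0" using b Cons.prems P_abelian by auto
  then have "bracket (bracket b x) a = bracket b (bracket x a)"
    using bracket_bracket_right [OF b(2) Cons.prems(2) Cons.hyps(1)]
      bracket_scale_left [of 0 0 x] by simp
  then show ?case
    using Cons.IH [OF _ bracket_grade [OF Cons.prems(2) Cons.hyps(1)]] Cons.prems by simp
qed simp

text \<open>
  Below, \<open>?c S\<close> is the coefficient in the Leibniz expansion of \<open>[D, D]\<close>, and \<open>?H\<close> is the half of the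
  expansion in which \<open>P\<close> is applied to the left factor.
\<close>

lemma derived_bracket_square_homogeneous:
  assumes D: "D \<in> grade 1" and as: "list_all2 (\<lambda>r a. a \<in> grade r) ps as" "set as \<subseteq> range P"
  shows "derived_bracket P bracket (scale (1 / 2) (bracket D D)) as =
    homogeneous_jacobiator (derived_bracket P bracket D) ps as"
proof -
  let ?n = "length as"
  let ?B = "derived_bracket P bracket D"
  let ?X = "\<lambda>S. foldl bracket D (nths as S)"
  let ?s = "\<lambda>S. sum_list (nths ps S)"
  let ?c = "\<lambda>S. unshuffle_sign ps S * parity_sign 1 (?s S) :: 'k"
  let ?H = "\<Sum>S \<in> Pow {..<?n}. scale (?c S) (P (bracket (P (?X S)) (?X (- S))))"
  have len: "length ps = ?n" using as(1) by (rule list_all2_lengthD)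
  have X: "?X S \<in> grade (1 + ?s S)" for S
    by (intro foldl_bracket_grade D list_all2_nths as(1))
  \<comment> \<open>Exchanging \<open>P (?X S)\<close>, of parity \<open>1 + ?s S\<close>, with the odd \<open>D\<close> costs \<open>parity_sign 1 (?s S)\<close>: the
    minus sign of antisymmetry cancels the one from the two odd parities. This removes the same
    factor from \<open>?c S\<close>.\<close>
  have outer: "scale (?c S) (P (bracket (P (?X S)) (?X (- S)))) =
      scale (unshuffle_sign ps S) (?B (?B (nths as S) # nths as (- S)))" for S
  proof -
    have PX: "P (?X S) \<in> grade (1 + ?s S)" by (intro P_grade X)
    have "bracket D (P (?X S)) = scale (- parity_sign 1 (1 + ?s S)) (bracket (P (?X S)) D)"
      using bracket_antisym [OF D PX] by simp
    also have "- parity_sign 1 (1 + ?s S) = (parity_sign 1 (?s S) :: 'k)"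
      by (simp add: parity_sign_add_right)
    finally have "foldl bracket (bracket D (P (?X S))) (nths as (- S)) =
        scale (parity_sign 1 (?s S)) (bracket (P (?X S)) (?X (- S)))"
      using foldl_bracket_range_left [OF _ PX D list_all2_nths [OF as(1)], of "- S"]
        as(2) set_nths_subset [of as "- S"] by (auto simp: foldl_bracket_scale)
    then show ?thesis by (simp add: derived_bracket_def P_scale)
  qed
  \<comment> \<open>The coefficients have the same symmetry as the bracket. Here it matters that both factors grow
    from an odd element: for even \<open>D\<close> the two halves would cancel instead.\<close>
  have swap: "scale (?c S) (P (bracket (?X S) (P (?X (- S))))) =
      scale (?c (- S)) (P (bracket (P (?X (- S))) (?X S)))" for S
  proof -
    have "bracket (?X S) (P (?X (- S))) = - scale (parity_sign (1 + ?s S) (1 + ?s (- S)))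
        (bracket (P (?X (- S))) (?X S))"
      by (intro bracket_antisym X P_grade)
    moreover have "- (?c S * parity_sign (1 + ?s S) (1 + ?s (- S))) = ?c (- S)"
      by (simp only: unshuffle_sign_Compl parity_sign_add_left parity_sign_add_right
          parity_sign_one_one parity_sign_commute [of "?s S" 1] parity_sign_square_left
          mult_minus_left mult_minus_right minus_minus mult_1_left mult_1_right mult_ac)
    ultimately show ?thesis by (simp add: P_minus P_scale flip: scale_minus_left)
  qed
  have "(\<Sum>S \<in> Pow {..<?n}. scale (?c (- S)) (P (bracket (P (?X (- S))) (?X S)))) = ?H"
  proof (rule sum.reindex_bij_witness [of _ "\<lambda>S. {..<?n} - S" "\<lambda>S. {..<?n} - S"], goal_cases)
    case (5 S)
    have "nths ps ({..<?n} - S) = nths ps (- S)" "nths as ({..<?n} - S) = nths as (- S)"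
        "nths as (- ({..<?n} - S)) = nths as S"
      by (rule nths_cong; use len in auto)+
    moreover have "unshuffle_sign ps ({..<?n} - S) = (unshuffle_sign ps (- S) :: 'k)"
      by (rule unshuffle_sign_cong) (use len in auto)
    ultimately show ?case by simp
  qed auto
  then have half: "(\<Sum>S \<in> Pow {..<?n}. scale (?c S) (P (bracket (?X S) (P (?X (- S)))))) = ?H"
    by (simp only: swap)
  have "P (foldl bracket (bracket D D) as) =
      (\<Sum>S \<in> Pow {..<?n}. scale (?c S) (P (bracket (?X S) (?X (- S)))))"
    by (simp add: foldl_bracket_Leibniz [OF D D as(1)] P_sum P_scale)
  also have "\<dots> = ?H + ?H"
    by (subst P_bracket) (simp only: scale_right_distrib sum.distrib half)
  finally have "derived_bracket P bracket (scale (1 / 2) (bracket D D)) as =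
      scale (1 / 2) (?H + ?H)"
    by (simp add: derived_bracket_def foldl_bracket_scale P_scale)
  also have "\<dots> = ?H"
    by (simp add: scale_right_distrib flip: scale_left_distrib)
  also have "\<dots> = homogeneous_jacobiator ?B ps as"
    by (simp only: outer homogeneous_jacobiator_eq_sum_subsets [OF len])
  finally show ?thesis .
qed

lemma jacobiator_derived_bracket:
  assumes D: "D \<in> grade 1" and as: "set as \<subseteq> range P"
  shows "jacobiator (derived_bracket P bracket D) as =
    derived_bracket P bracket (scale (1 / 2) (bracket D D)) as"
proof -
  have "homogeneous_jacobiator (derived_bracket P bracket D) ps (map2 component ps as) =
      derived_bracket P bracket (scale (1 / 2) (bracket D D)) (map2 component ps as)"
    if "length ps = length as" for ps
  proof (rule derived_bracket_square_homogeneous [OF D, symmetric])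
    show "list_all2 (\<lambda>r a. a \<in> grade r) ps (map2 component ps as)"
      using that by (simp add: list_all2_conv_all_nth component_in_grade)
    show "set (map2 component ps as) \<subseteq> range P"
      using as by (auto dest!: set_zip_rightD intro: component_in_range)
  qed
  then have "jacobiator (derived_bracket P bracket D) as =
      (\<Sum>ps \<in> {ps. length ps = length as}.
        P (foldl bracket (scale (1 / 2) (bracket D D)) (map2 component ps as)))"
    by (simp add: jacobiator_def derived_bracket_def)
  also have "\<dots> = P (foldl bracket (scale (1 / 2) (bracket D D)) as)"
    by (simp only: foldl_bracket_components [of _ as] P_sum)
  finally show ?thesis by (simp only: derived_bracket_def)
qed

end

theorem theorem1:
  fixes scale :: "'k::field_char_0 \<Rightarrow> 'a::ab_group_add \<Rightarrow> 'a"
    and grade :: "bit \<Rightarrow> 'a set"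
    and bracket :: "'a \<Rightarrow> 'a \<Rightarrow> 'a"
    and P :: "'a \<Rightarrow> 'a"
    and \<Delta> :: 'a
    and n :: nat
    and as :: "'a list"
  assumes "lie_superalgebra scale grade bracket"
    and "Vector_Spaces.linear scale scale P"
    and "\<And>p a. a \<in> grade p \<Longrightarrow> P a \<in> grade p"
    and "\<And>a. P (P a) = P a"
    and "\<And>a b. bracket (P a) (P b) = 0"
    and "\<And>a b. P (bracket a b) = P (bracket (P a) b) + P (bracket a (P b))"
    and "\<Delta> \<in> grade 1"
    and "length as = n"
    and "set as \<subseteq> range P"
  shows "super_space.jacobiator scale grade (derived_bracket P bracket \<Delta>) as =
    derived_bracket P bracket (scale (1 / 2) (bracket \<Delta> \<Delta>)) as"
proof -
  interpret lie_superalgebra_projection scale grade bracket P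
    by (intro lie_superalgebra_projection.intro lie_superalgebra_projection_axioms.intro) (fact assms)+
  show ?thesis using assms(7,9) by (rule jacobiator_derived_bracket)
qed

end
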